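(* Let $G$ be a simple undirected bipartite graph. The following are equivalent: (1) there is a signing $\phi:E(G)\to\{1,-1\}$ such that the adjacency matrix of the signed graph $(G,\phi)$ has exactly two distinct eigenvalues; (2) there is an orientation $D$ of $G$ such that $H_i(D)$ has exactly two distinct eigenvalues.
   Context: A signed graph $(G,\phi)$ consists of a graph $G$ and a map $\phi:E(G)\to\{1,-1\}$; its adjacency matrix $S$ has $(u,v)$-entry $\phi(\{u,v\})$ if $\{u,v\}\in E(G)$ and $0$ otherwise. An orientation of $G$ is an oriented graph obtained by replacing each edge $\{u,v\}$ by exactly one of the arcs $u\to v$ or $v\to u$. For an oriented graph $D$, $H_i(D)$ is the matrix with $(u,v)$-entry $i$ if $u\to v$, $-i$ if $v\to u$, and $0$ otherwise (here $i=\sqrt{-1}$). *)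

theory Defs
  imports Complex_Main "Jordan_Normal_Form.Spectral_Radius"
begin

definition simple_graph :: "'a set \<Rightarrow> 'a set set \<Rightarrow> bool" where
  "simple_graph V E \<longleftrightarrow> finite V \<and> (\<forall>e\<in>E. e \<subseteq> V \<and> card e = 2)"

definition bipartite :: "'a set \<Rightarrow> 'a set set \<Rightarrow> bool" where
  "bipartite V E \<longleftrightarrow>
     (\<exists>X Y. X \<union> Y = V \<and> X \<inter> Y = {} \<and> (\<forall>e\<in>E. \<exists>x\<in>X. \<exists>y\<in>Y. e = {x, y}))"

definition signing :: "'a set set \<Rightarrow> ('a set \<Rightarrow> int) \<Rightarrow> bool" where
  "signing E \<phi> \<longleftrightarrow> (\<forall>e\<in>E. \<phi> e \<in> {1, -1})"

text \<open>An orientation is a set of arcs, \<open>(u, v)\<close> standing for \<open>u \<rightarrow> v\<close>.\<close>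

definition orientation :: "'a set set \<Rightarrow> ('a \<times> 'a) set \<Rightarrow> bool" where
  "orientation E D \<longleftrightarrow>
     (\<forall>(u, v)\<in>D. {u, v} \<in> E) \<and>
     (\<forall>u v. {u, v} \<in> E \<longrightarrow> ((u, v) \<in> D \<longleftrightarrow> (v, u) \<notin> D))"

text \<open>Library matrices are indexed by natural numbers, so the matrices of a graph are taken
  with respect to a list \<open>vs\<close> enumerating its vertices without repetition. Both are complex
  matrices, so that their spectra consist of all complex eigenvalues.\<close>

definition signed_adj_mat :: "'a list \<Rightarrow> 'a set set \<Rightarrow> ('a set \<Rightarrow> int) \<Rightarrow> complex mat" where
  "signed_adj_mat vs E \<phi> = mat (length vs) (length vs)
     (\<lambda>(i, j). if {vs ! i, vs ! j} \<in> E then of_int (\<phi> {vs ! i, vs ! j}) else 0)"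

definition H_mat :: "'a list \<Rightarrow> ('a \<times> 'a) set \<Rightarrow> complex mat" where
  "H_mat vs D = mat (length vs) (length vs)
     (\<lambda>(i, j). if (vs ! i, vs ! j) \<in> D then \<i>
               else if (vs ! j, vs ! i) \<in> D then - \<i> else 0)"

end

theory Submission
  imports Defs
begin

text \<open>Let \<open>P\<close> be the diagonal matrix with entry \<open>1\<close> on one side of the bipartition and
  \<open>\<i>\<close> on the other. Conjugating the signed adjacency matrix by \<open>P\<close> multiplies its entries by
  \<open>\<i>\<close> in one off-diagonal block and by \<open>- \<i>\<close> in the other, which yields \<open>H\<^sub>i(D)\<close> for an
  orientation \<open>D\<close>. Signings and orientations correspond bijectively in this way,
  and corresponding matrices have equal spectra.\<close>

text \<open>The relation \<open>AB\<close> is \<open>A * P = P * B\<close> for the invertible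
  diagonal matrix \<open>P\<close> of \<open>d\<close>, so \<open>A\<close> and \<open>B\<close> are
  similar and share their characteristic polynomial. In this form only single entries have to be
  compared.\<close>

lemma spectrum_diagonal_similar:
  fixes A B :: "'a :: field mat"
  assumes A: "A \<in> carrier_mat n n" and B: "B \<in> carrier_mat n n"
    and d: "\<And>i. i < n \<Longrightarrow> d i \<noteq> 0"
    and AB: "\<And>i j. i < n \<Longrightarrow> j < n \<Longrightarrow> A $$ (i, j) * d j = d i * B $$ (i, j)"
  shows "spectrum A = spectrum B"
proof -
  define P where "P = mat_diag n d"
  define Q where "Q = mat_diag n (\<lambda>i. inverse (d i))"
  have P: "P \<in> carrier_mat n n" and Q: "Q \<in> carrier_mat n n"
    by (simp_all add: P_def Q_def)
  have PQ: "P * Q = 1\<^sub>m n" "Q * P = 1\<^sub>m n"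
    unfolding P_def Q_def mat_diag_diag using d by (auto simp: mat_diag_def)
  have AP: "A * P = P * B"
    unfolding P_def mat_diag_mult_left[OF B] mat_diag_mult_right[OF A]
    by (rule eq_matI) (simp_all add: AB)
  have "P * B * Q = A * (P * Q)"
    unfolding AP[symmetric] by (rule assoc_mult_mat[OF A P Q])
  then have "A = P * B * Q"
    using A PQ by simp
  then have "similar_mat A B"
    using A B P Q PQ by (intro similar_matI[of _ _ P Q n]) simp_all
  then have "char_poly A = char_poly B"
    by (rule char_poly_similar)
  then show ?thesis
    by (auto simp: spectrum_def eigenvalue_root_char_poly[OF A] eigenvalue_root_char_poly[OF B])
qed

text \<open>By \<open>compat\<close>, positive edges point out of \<open>X\<close> and negative ones
  into \<open>X\<close>; this is the correspondence that the diagonal conjugation induces.\<close>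

lemma spectrum_signed_adj_mat_eq_H_mat:
  assumes "signing E \<phi>" and "orientation E D"
    and parts: "X \<inter> Y = {}" "\<forall>e\<in>E. \<exists>x\<in>X. \<exists>y\<in>Y. e = {x, y}"
    and compat: "\<And>u v. {u, v} \<in> E \<Longrightarrow> (u, v) \<in> D \<longleftrightarrow> (\<phi> {u, v} = 1 \<longleftrightarrow> u \<in> X)"
  shows "spectrum (signed_adj_mat vs E \<phi>) = spectrum (H_mat vs D)"
proof (rule spectrum_diagonal_similar)
  let ?n = "length vs" and ?d = "\<lambda>i. if vs ! i \<in> X then 1 else \<i>"
  show "signed_adj_mat vs E \<phi> \<in> carrier_mat ?n ?n" "H_mat vs D \<in> carrier_mat ?n ?n"
    by (simp_all add: signed_adj_mat_def H_mat_def)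
  show "?d i \<noteq> 0" for i
    by simp
  fix i j
  assume ij: "i < ?n" "j < ?n"
  let ?u = "vs ! i" and ?v = "vs ! j"
  show "signed_adj_mat vs E \<phi> $$ (i, j) * ?d j = ?d i * H_mat vs D $$ (i, j)"
  proof (cases "{?u, ?v} \<in> E")
    case True
    then have X: "?u \<in> X \<longleftrightarrow> ?v \<notin> X"
      using parts by (fastforce simp: doubleton_eq_iff)
    have D: "(?u, ?v) \<in> D \<longleftrightarrow> (\<phi> {?u, ?v} = 1 \<longleftrightarrow> ?u \<in> X)"
      "(?v, ?u) \<in> D \<longleftrightarrow> (?u, ?v) \<notin> D"
      using True compat[of ?u ?v] \<open>orientation E D\<close> by (auto simp: orientation_def)
    have "\<phi> {?u, ?v} = 1 \<or> \<phi> {?u, ?v} = -1"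
      using True \<open>signing E \<phi>\<close> by (auto simp: signing_def)
    \<comment> \<open>The entry of \<open>H_mat\<close> has to be the sign times \<open>\<i>\<close>
      if \<open>?u\<close> lies in \<open>X\<close>, and times \<open>1 / \<i> = - \<i>\<close>
      otherwise.\<close>
    with True X D ij show ?thesis
      by (auto simp: signed_adj_mat_def H_mat_def)
  next
    case False
    then have "{?v, ?u} \<notin> E"
      by (simp add: insert_commute)
    moreover have "\<forall>(u, v)\<in>D. {u, v} \<in> E"
      using \<open>orientation E D\<close> unfolding orientation_def by (rule conjunct1)
    ultimately have "(?u, ?v) \<notin> D" "(?v, ?u) \<notin> D"
      using False by blast+
    with False ij show ?thesis
      by (simp add: signed_adj_mat_def H_mat_def)
  qed
qed

theorem theorem4p2:
  fixes V :: "'a set" and E :: "'a set set" and vs :: "'a list"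
  assumes "simple_graph V E"
    and "bipartite V E"
    and "distinct vs" and "set vs = V"
  shows "(\<exists>\<phi>. signing E \<phi> \<and> card (spectrum (signed_adj_mat vs E \<phi>)) = 2) \<longleftrightarrow>
         (\<exists>D. orientation E D \<and> card (spectrum (H_mat vs D)) = 2)"
proof -
  obtain X Y where parts: "X \<inter> Y = {}" "\<forall>e\<in>E. \<exists>x\<in>X. \<exists>y\<in>Y. e = {x, y}"
    using \<open>bipartite V E\<close> unfolding bipartite_def by blast
  have X: "u \<in> X \<longleftrightarrow> v \<notin> X" if "{u, v} \<in> E" for u v
    using that parts by (fastforce simp: doubleton_eq_iff)
  show ?thesis
  proof (intro iffI; elim exE conjE)
    fix \<phi>
    assume \<phi>: "signing E \<phi>" and card: "card (spectrum (signed_adj_mat vs E \<phi>)) = 2"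
    define D where "D = {(u, v). {u, v} \<in> E \<and> (\<phi> {u, v} = 1 \<longleftrightarrow> u \<in> X)}"
    have D: "orientation E D"
      \<comment> \<open>Exactly one end of an edge lies in \<open>X\<close>, so swapping
        \<open>u\<close> and \<open>v\<close> negates the condition in \<open>D\<close>.\<close>
      using X by (fastforce simp: orientation_def D_def insert_commute)
    have "spectrum (signed_adj_mat vs E \<phi>) = spectrum (H_mat vs D)"
      by (rule spectrum_signed_adj_mat_eq_H_mat[OF \<phi> D parts]) (simp add: D_def)
    with D card show "\<exists>D. orientation E D \<and> card (spectrum (H_mat vs D)) = 2"
      by auto
  next
    fix D
    assume D: "orientation E D" and card: "card (spectrum (H_mat vs D)) = 2"
    \<comment> \<open>An edge is an unordered pair, so its sign is read off at its end in
      \<open>X\<close>: it is 1 when the arc leaves that end.\<close>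
    define \<phi> :: "'a set \<Rightarrow> int"
      where "\<phi> e = (if \<exists>x\<in>X. \<exists>y. e = {x, y} \<and> (x, y) \<in> D then 1 else -1)" for e
    have \<phi>: "signing E \<phi>"
      by (simp add: signing_def \<phi>_def)
    have "(u, v) \<in> D \<longleftrightarrow> (\<phi> {u, v} = 1 \<longleftrightarrow> u \<in> X)" if "{u, v} \<in> E" for u v
    proof -
      have "(v, u) \<in> D \<longleftrightarrow> (u, v) \<notin> D"
        using D that by (auto simp: orientation_def)
      then show ?thesis
        \<comment> \<open>If \<open>u\<close> is not in \<open>X\<close>, the sign tests the reverse
          arc \<open>(v, u)\<close>, which is in \<open>D\<close> exactly when \<open>(u, v)\<close>
          is not.\<close>
        using X[OF that] by (auto simp: \<phi>_def doubleton_eq_iff)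
    qed
    then have "spectrum (signed_adj_mat vs E \<phi>) = spectrum (H_mat vs D)"
      by (rule spectrum_signed_adj_mat_eq_H_mat[OF \<phi> D parts])
    with \<phi> card show "\<exists>\<phi>. signing E \<phi> \<and> card (spectrum (signed_adj_mat vs E \<phi>)) = 2"
      by auto
  qed
qed

end
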